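(* For every $m\in\mathbb{N}_0$, $$\sum_{n=0}^\infty\left[\frac{1}{4^n}\binom{2n}{n}\right]^2\frac{1}{(n+1)^{m+1}}=\frac{4}{\pi}\left\{1+\sum_{k=1}^m\sum_{n=1}^\infty\frac{\zeta_{n-1}(1_{k-1})\zeta^\star_{n+1}(1_{m-k})}{n(n+1)(2n+1)}(-1)^n\right\},$$ $$\sum_{n=0}^\infty\left[\frac{1}{4^n}\binom{2n}{n}\right]^2\frac{\zeta^\star_{n+1}(1_m)}{n+1}=\frac{4}{\pi}\left\{1+\sum_{k=1}^m\sum_{n=1}^\infty\frac{\zeta_{n-1}(1_{k-1})\zeta^\star_{n+1}(1_{m-k})}{n(n+1)(2n+1)}\right\}.$$
   Context: For a composition $\mathbf{k}=(k_1,\dots,k_r)$ and $n\in\mathbb{N}_0$: $\zeta_n(\mathbf{k})=\sum_{n\ge n_1>\cdots>n_r>0}\prod_j n_j^{-k_j}$, $\zeta^\star_n(\mathbf{k})=\sum_{n\ge n_1\ge\cdots\ge n_r>0}\prod_j n_j^{-k_j}$, with value $1$ on the empty composition and empty sums equal to $0$. $1_d$ is the string of $d$ ones. *)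

theory Defs
  imports Complex_Main
begin

text \<open>Truncated multiple harmonic (star) sums. A composition is represented by the list of its
  parts, and an index tuple \<open>(n\<^sub>1, \<dots>, n\<^sub>r)\<close> by a list of the same length. Both index sets are finite.\<close>

definition mhs :: "nat \<Rightarrow> nat list \<Rightarrow> real" where
  "mhs n ks = (\<Sum>ns | length ns = length ks \<and> set ns \<subseteq> {1..n} \<and> sorted_wrt (>) ns.
     \<Prod>j<length ks. 1 / real (ns ! j) ^ (ks ! j))"

definition mhs_star :: "nat \<Rightarrow> nat list \<Rightarrow> real" where
  "mhs_star n ks = (\<Sum>ns | length ns = length ks \<and> set ns \<subseteq> {1..n} \<and> sorted_wrt (\<ge>) ns.
     \<Prod>j<length ks. 1 / real (ns ! j) ^ (ks ! j))"

abbreviation ones :: "nat \<Rightarrow> nat list" where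
  "ones d \<equiv> replicate d 1"

end

(* Let L(n) = (X)_n / (1 - X)_{n+1} as a formal power series: for n > 0 the coefficient of X^m is the
   inner sum over k of the theorem, divided by n(n+1). With
   w(N,n) = N! (N+1)! / ((N-n)! (N+n+1)!), creative telescoping in n gives
     sum_n (2n+1) w(N,n) (-1)^n L(n) = (N+1) / (N+1-X),
     sum_n (2n+1) w(N,n) L(n) = 1 / prod_{j<=N+1} (1 - X/j),
   whose coefficients are those of the two left-hand sides. For an arbitrary sequence x, with a(k) the
   squared central binomial weight, induction on N shows
     sum_{k<=N} a(k)/(k+1) sum_{n<=k} (2n+1) w(k,n) x(n)
       = a(N) (2N+1)^2/(N+1) sum_{n<=N} w(N,n) x(n)/(2n+1).
   As N grows, the prefactor tends to 4/pi by Wallis and w(N,n) to 1, dominated by 1. *)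
theory Submission
  imports Defs "HOL-Analysis.Analysis" "HOL-Real_Asymp.Real_Asymp"
begin

section \<open>Truncated multiple harmonic sums\<close>

lemma mhs_Nil [simp]: "mhs n [] = 1"
proof -
  have "{ns :: nat list. length ns = length ([] :: nat list) \<and> set ns \<subseteq> {1..n} \<and> sorted_wrt (>) ns} = {[]}"
    by auto
  then show ?thesis
    by (simp add: mhs_def)
qed

lemma mhs_star_Nil [simp]: "mhs_star n [] = 1"
proof -
  have "{ns :: nat list. length ns = length ([] :: nat list) \<and> set ns \<subseteq> {1..n} \<and> sorted_wrt (\<ge>) ns} = {[]}"
    by auto
  then show ?thesis
    by (simp add: mhs_star_def)
qed

lemma mhs_0_Cons [simp]: "mhs 0 (k # ks) = 0"
proof -
  have "{ns :: nat list. length ns = length (k # ks) \<and> set ns \<subseteq> {1..0} \<and> sorted_wrt (>) ns} = {}"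
    by auto
  then show ?thesis
    unfolding mhs_def by (simp only: sum.empty)
qed

lemma mhs_star_0_Cons [simp]: "mhs_star 0 (k # ks) = 0"
proof -
  have "{ns :: nat list. length ns = length (k # ks) \<and> set ns \<subseteq> {1..0} \<and> sorted_wrt (\<ge>) ns} = {}"
    by auto
  then show ?thesis
    unfolding mhs_star_def by (simp only: sum.empty)
qed

lemma finite_bounded_lists:
  "finite {ns :: nat list. length ns = l \<and> set ns \<subseteq> {1..n} \<and> P ns}"
  by (rule finite_subset[OF _ finite_lists_length_eq[of "{1..n}" l]]) auto

text \<open>Case split on the largest index: either it is at most \<open>n\<close>, or it equals
  \<open>Suc n\<close> and strict decrease confines the remaining indices to
  \<open>{1..n}\<close>.\<close>

lemma mhs_Suc_Cons:
  "mhs (Suc n) (k # ks) = mhs n (k # ks) + mhs n ks / real (Suc n) ^ k"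
proof -
  define A where "A = {ns. length ns = length (k # ks) \<and> set ns \<subseteq> {1..n} \<and> sorted_wrt (>) ns}"
  define B where "B = {ns. length ns = length ks \<and> set ns \<subseteq> {1..n} \<and> sorted_wrt (>) ns}"
  let ?f = "\<lambda>ks ns. \<Prod>j<length ks. 1 / real (ns ! j) ^ (ks ! j)"
  have split: "{ns. length ns = length (k # ks) \<and> set ns \<subseteq> {1..Suc n} \<and> sorted_wrt (>) ns}
      = A \<union> (#) (Suc n) ` B" (is "?X = _")
  proof (intro equalityI subsetI)
    fix ns assume ns: "ns \<in> ?X"
    then obtain a as where eq: "ns = a # as" by (cases ns) auto
    show "ns \<in> A \<union> (#) (Suc n) ` B"
    proof (cases "a = Suc n")
      case True
      with ns eq have "as \<in> B" by (fastforce simp: B_def)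
      with True eq show ?thesis by auto
    next
      case False
      with ns eq have "ns \<in> A" by (fastforce simp: A_def)
      then show ?thesis by auto
    qed
  next
    fix ns assume "ns \<in> A \<union> (#) (Suc n) ` B"
    then show "ns \<in> ?X" by (fastforce simp: A_def B_def)
  qed
  have fin: "finite A" "finite B"
    unfolding A_def B_def by (rule finite_bounded_lists)+
  have disj: "A \<inter> (#) (Suc n) ` B = {}" by (auto simp: A_def)
  have "mhs (Suc n) (k # ks) = sum (?f (k # ks)) A + sum (?f (k # ks)) ((#) (Suc n) ` B)"
    unfolding mhs_def split
    by (rule sum.union_disjoint) (simp_all only: fin finite_imageI disj)
  also have "sum (?f (k # ks)) A = mhs n (k # ks)"
    by (simp add: mhs_def A_def)
  also have "sum (?f (k # ks)) ((#) (Suc n) ` B) = (\<Sum>ns\<in>B. ?f ks ns / real (Suc n) ^ k)"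
    by (subst sum.reindex) (auto simp: prod.lessThan_Suc_shift simp del: prod.lessThan_Suc intro!: sum.cong)
  also have "\<dots> = mhs n ks / real (Suc n) ^ k"
    by (simp add: mhs_def B_def sum_divide_distrib)
  finally show ?thesis .
qed

text \<open>Same split as for \<open>mhs\<close>, but neighbours may be equal: after a leading
  \<open>Suc n\<close> the remaining indices still range up to \<open>Suc n\<close>.\<close>

lemma mhs_star_Suc_Cons:
  "mhs_star (Suc n) (k # ks) = mhs_star n (k # ks) + mhs_star (Suc n) ks / real (Suc n) ^ k"
proof -
  define A where "A = {ns. length ns = length (k # ks) \<and> set ns \<subseteq> {1..n} \<and> sorted_wrt (\<ge>) ns}"
  define B where "B = {ns. length ns = length ks \<and> set ns \<subseteq> {1..Suc n} \<and> sorted_wrt (\<ge>) ns}"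
  let ?f = "\<lambda>ks ns. \<Prod>j<length ks. 1 / real (ns ! j) ^ (ks ! j)"
  have split: "{ns. length ns = length (k # ks) \<and> set ns \<subseteq> {1..Suc n} \<and> sorted_wrt (\<ge>) ns}
      = A \<union> (#) (Suc n) ` B" (is "?X = _")
  proof (intro equalityI subsetI)
    fix ns assume ns: "ns \<in> ?X"
    then obtain a as where eq: "ns = a # as" by (cases ns) auto
    show "ns \<in> A \<union> (#) (Suc n) ` B"
    proof (cases "a = Suc n")
      case True
      with ns eq have "as \<in> B" by (fastforce simp: B_def)
      with True eq show ?thesis by auto
    next
      case False
      with ns eq have "ns \<in> A" by (fastforce simp: A_def)
      then show ?thesis by auto
    qed
  next
    fix ns assume "ns \<in> A \<union> (#) (Suc n) ` B"
    then show "ns \<in> ?X" by (fastforce simp: A_def B_def)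
  qed
  have fin: "finite A" "finite B"
    unfolding A_def B_def by (rule finite_bounded_lists)+
  have disj: "A \<inter> (#) (Suc n) ` B = {}" by (auto simp: A_def)
  have "mhs_star (Suc n) (k # ks) = sum (?f (k # ks)) A + sum (?f (k # ks)) ((#) (Suc n) ` B)"
    unfolding mhs_star_def split
    by (rule sum.union_disjoint) (simp_all only: fin finite_imageI disj)
  also have "sum (?f (k # ks)) A = mhs_star n (k # ks)"
    by (simp add: mhs_star_def A_def)
  also have "sum (?f (k # ks)) ((#) (Suc n) ` B) = (\<Sum>ns\<in>B. ?f ks ns / real (Suc n) ^ k)"
    by (subst sum.reindex) (auto simp: prod.lessThan_Suc_shift simp del: prod.lessThan_Suc intro!: sum.cong)
  also have "\<dots> = mhs_star (Suc n) ks / real (Suc n) ^ k"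
    by (simp add: mhs_star_def B_def sum_divide_distrib)
  finally show ?thesis .
qed

section \<open>Growth of the harmonic sums and a convergent comparison series\<close>

lemma mhs_nonneg: "mhs n ks \<ge> 0"
  unfolding mhs_def by (intro sum_nonneg prod_nonneg) auto

lemma mhs_star_nonneg: "mhs_star n ks \<ge> 0"
  unfolding mhs_star_def by (intro sum_nonneg prod_nonneg) auto

text \<open>Expanding the power gives all index tuples, of which the strictly decreasing ones are
  only a part. With the logarithmic growth of \<open>harm\<close> this leads to the majorant for all
  summability claims.\<close>

lemma mhs_ones_le: "mhs n (ones k) \<le> harm n ^ k"
proof (induction n arbitrary: k)
  case 0
  show ?case by (cases k) (auto simp: harm_def)
next
  case (Suc n)
  show ?case
  proof (cases k)
    case (Suc l)
    have "mhs (Suc n) (ones k) \<le> harm n ^ Suc l + harm n ^ l / real (Suc n)"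
      using Suc.IH[of "Suc l"] Suc.IH[of l]
      by (simp add: Suc mhs_Suc_Cons divide_right_mono add_mono)
    also have "\<dots> = harm n ^ l * harm (Suc n)"
      by (simp add: harm_Suc field_simps)
    also have "\<dots> \<le> harm (Suc n) ^ l * harm (Suc n)"
      by (intro mult_right_mono power_mono harm_mono harm_nonneg) auto
    finally show ?thesis by (simp add: Suc mult_ac)
  qed auto
qed

lemma mhs_star_ones_le: "mhs_star n (ones k) \<le> harm n ^ k"
proof (induction n arbitrary: k)
  case 0
  show ?case by (cases k) (auto simp: harm_def)
next
  case (Suc n)
  note IH_n = Suc.IH
  show ?case
  \<comment> \<open>The star recursion keeps the bound \<open>Suc n\<close> in its second summand
    and only shortens the composition, so an inner induction on the depth is needed.\<close>
  proof (induction k)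
    case (Suc l)
    have "mhs_star (Suc n) (ones (Suc l)) \<le> harm n ^ Suc l + harm (Suc n) ^ l / real (Suc n)"
      using IH_n[of "Suc l"] Suc.IH
      by (simp add: mhs_star_Suc_Cons divide_right_mono add_mono)
    also have "harm n ^ Suc l \<le> harm (Suc n) ^ l * (harm n :: real)"
      by (simp only: power_Suc2) (intro mult_right_mono power_mono harm_mono harm_nonneg, simp)
    also have "harm (Suc n) ^ l * harm n + harm (Suc n) ^ l / real (Suc n) = harm (Suc n) ^ Suc l"
      by (simp only: harm_Suc power_Suc2 distrib_left divide_inverse)
    finally show ?case by simp
  qed auto
qed

lemma harm_le_one_plus_ln: "harm (Suc n) \<le> (1 + ln (real (Suc n)) :: real)"
  using decseqD[OF decseq_harm_diff_ln, of 0 n] by (simp add: harm_expand)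

lemma summable_harm_power_over_square:
  "summable (\<lambda>n. harm (Suc (Suc n)) ^ p / real (Suc n) ^ 2 :: real)"
proof (rule summable_comparison_test)
  show "\<exists>N. \<forall>n\<ge>N. norm (harm (Suc (Suc n)) ^ p / real (Suc n) ^ 2 :: real)
      \<le> (1 + ln (real (Suc (Suc n)))) ^ p / real (Suc n) ^ 2"
    by (auto simp: norm_divide power_abs simp del: of_nat_Suc
        intro!: exI[of _ 0] divide_right_mono power_mono harm_le_one_plus_ln harm_nonneg)
  \<comment> \<open>Any exponent strictly between -2 and -1 would do: the gap to -2 absorbs the
    power of the logarithm, and being below -1 gives summability.\<close>
  have "(\<lambda>n. (1 + ln (real (Suc (Suc n)))) powr real p / real (Suc n) ^ 2)
      \<in> O(\<lambda>n. real n powr (-3/2))"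
    by real_asymp
  moreover have "(1 + ln (real (Suc (Suc n)))) powr real p = (1 + ln (real (Suc (Suc n)))) ^ p" for n
    by (subst powr_realpow) (auto intro: add_pos_nonneg)
  ultimately have "(\<lambda>n. (1 + ln (real (Suc (Suc n)))) ^ p / real (Suc n) ^ 2)
      \<in> O(\<lambda>n. real n powr (-3/2))" by simp
  then show "summable (\<lambda>n. (1 + ln (real (Suc (Suc n)))) ^ p / real (Suc n) ^ 2)"
    by (rule summable_comparison_test_bigo[rotated]) (simp add: summable_real_powr_iff)
qed

section \<open>The basic weight\<close>

text \<open>This is the quotient of the binomial coefficients \<open>(2N+1) choose (N-n)\<close> and
  \<open>(2N+1) choose N\<close>. The value 0 beyond \<open>N\<close> lets sums for different
  \<open>N\<close> run over a common range and makes the upper boundary terms of the telescoping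
  sums vanish.\<close>

definition binom_weight :: "nat \<Rightarrow> nat \<Rightarrow> real" where
  "binom_weight N n = (if n \<le> N then fact N * fact (N + 1) / (fact (N - n) * fact (N + n + 1)) else 0)"

lemma binom_weight_0 [simp]: "binom_weight N 0 = 1"
  by (simp add: binom_weight_def)

lemma binom_weight_eq_0 [simp]: "N < n \<Longrightarrow> binom_weight N n = 0"
  by (simp add: binom_weight_def)

text \<open>Kept free of division, so that it holds for every \<open>n\<close>, including the edge
  \<open>n = N\<close>, where the factor \<open>N - n\<close> vanishes.\<close>

lemma binom_weight_Suc_right: "binom_weight N (Suc n) * (real N + real n + 2) = (real N - real n) * binom_weight N n"
proof (cases "n < N")
  case True
  then obtain d where "N = n + Suc d" using less_imp_Suc_add by auto
  then show ?thesis by (simp add: binom_weight_def divide_simps)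
qed (cases "n = N"; simp)

lemma binom_weight_Suc_left:
  "(real N + 1) * (real N + 2) * binom_weight N n
    = (real N + 1 - real n) * (real N + real n + 2) * binom_weight (Suc N) n"
proof (cases "n \<le> N")
  case True
  then obtain d where "N = n + d" using le_Suc_ex by blast
  then show ?thesis by (simp add: binom_weight_def divide_simps Suc_diff_le) (simp add: algebra_simps)
qed (cases "n = Suc N"; simp)

lemma binom_weight_nonneg: "binom_weight N n \<ge> 0"
  by (simp add: binom_weight_def)

text \<open>For \<open>n < N\<close> the ratio of consecutive weights is (N-n)/(N+n+2), at most 1,
  so the weights decrease in \<open>n\<close> from the value 1. For fixed \<open>n\<close> this
  ratio tends to 1 as \<open>N\<close> grows, which gives the limit of the weights below.\<close>

lemma binom_weight_le_1: "binom_weight N n \<le> 1"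
proof (induction n)
  case (Suc n)
  show ?case
  proof (cases "n < N")
    case True
    then have "binom_weight N (Suc n) = (real N - real n) / (real N + real n + 2) * binom_weight N n"
      using binom_weight_Suc_right[of N n] by (simp add: divide_simps)
    also have "\<dots> \<le> 1 * 1"
      using True Suc binom_weight_nonneg by (intro mult_mono) (auto simp: divide_simps)
    finally show ?thesis by simp
  qed simp
qed simp

lemma binom_weight_tendsto_1: "(\<lambda>N. binom_weight N n) \<longlonglongrightarrow> 1"
proof (induction n)
  case (Suc n)
  have "(\<lambda>N. (real N - real n) / (real N + real n + 2)) \<longlonglongrightarrow> 1" by real_asymp
  from tendsto_mult[OF this Suc] have "(\<lambda>N. (real N - real n) / (real N + real n + 2) * binom_weight N n) \<longlonglongrightarrow> 1"
    by simp
  moreover have "(real N - real n) / (real N + real n + 2) * binom_weight N n = binom_weight N (Suc n)" for N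
    using binom_weight_Suc_right[of N n] by (simp add: divide_simps)
  ultimately show ?case by simp
qed simp

section \<open>Summation by the squared central binomial weights\<close>

definition cbin :: "nat \<Rightarrow> real" where
  "cbin n = (1 / 4 ^ n * real ((2 * n) choose n))\<^sup>2"

lemma cbin_0 [simp]: "cbin 0 = 1"
  by (simp add: cbin_def)

lemma central_binomial_Suc:
  "(real n + 1) * real ((2 * Suc n) choose Suc n) = 2 * (2 * real n + 1) * real ((2 * n) choose n)"
proof -
  have *: "real ((2 * n) choose n) = fact (2 * n) / (fact n * fact n)" for n
    by (subst binomial_fact) auto
  have "fact (2 * Suc n) = (2 * (real n + 1)) * (2 * real n + 1) * fact (2 * n)"
    by (simp add: algebra_simps)
  moreover have "fact (Suc n) = (real n + 1) * fact n"
    by simp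
  moreover have "x * (2 * x * y * f / (x * g * (x * g))) = 2 * y * (f / (g * g))"
    if "x \<noteq> 0" "g \<noteq> 0" for x y f g :: real
    using that by (simp add: field_simps)
  from this[of "real n + 1" "fact n"] have "(real n + 1) * (2 * (real n + 1) * (2 * real n + 1) * fact (2 * n)
      / ((real n + 1) * fact n * ((real n + 1) * fact n))) = 2 * (2 * real n + 1) * (fact (2 * n) / (fact n * fact n))"
    by auto
  ultimately show ?thesis
    unfolding * by (simp only:)
qed

lemma cbin_Suc: "cbin (Suc n) = cbin n * (2 * real n + 1)\<^sup>2 / (2 * real n + 2)\<^sup>2"
proof -
  define c where "c = real ((2 * Suc n) choose Suc n)"
  define d where "d = real ((2 * n) choose n)"
  have "c = 2 * (2 * real n + 1) / (real n + 1) * d"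
    using central_binomial_Suc[of n] by (simp add: c_def d_def field_simps)
  then have "1 / 4 ^ Suc n * c = 1 / 4 ^ n * d * ((2 * real n + 1) / (2 * real n + 2))"
    by (simp add: divide_simps) (simp add: algebra_simps)
  then show ?thesis
    unfolding cbin_def c_def[symmetric] d_def[symmetric] by (simp only: power_mult_distrib power_divide times_divide_eq_right)
qed

text \<open>The new Wallis factor is (2n+2)^2 / ((2n+1)(2n+3)), which cancels exactly the growth of
  \<open>cbin n * (2 * real n + 1)\<close> from \<open>n\<close> to \<open>Suc n\<close>.\<close>

lemma cbin_wallis: "cbin n * (2 * real n + 1) * (\<Prod>k=1..n. (4 * real k ^ 2) / (4 * real k ^ 2 - 1)) = 1"
proof (induction n)
  case (Suc n)
  let ?f = "\<lambda>k. (4 * real k ^ 2) / (4 * real k ^ 2 - 1)"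
  have f: "?f (Suc n) = (2 * real n + 2)\<^sup>2 / ((2 * real n + 1) * (2 * real n + 3))"
    by (rule arg_cong2[where f = "(/)"]) (simp_all add: power2_eq_square algebra_simps)
  have "c * a\<^sup>2 / b\<^sup>2 * d * (b\<^sup>2 / (a * d)) = c * a" if "a \<noteq> 0" "b \<noteq> 0" "d \<noteq> 0" for a b c d :: real
    using that by (simp add: power2_eq_square)
  from this[of "2 * real n + 1" "2 * real n + 2" "2 * real n + 3" "cbin n"]
  have step: "cbin (Suc n) * (2 * real (Suc n) + 1) * ?f (Suc n) = cbin n * (2 * real n + 1)"
    unfolding f cbin_Suc by (simp add: add_ac)
  have "cbin (Suc n) * (2 * real (Suc n) + 1) * (\<Prod>k=1..Suc n. ?f k)
      = cbin (Suc n) * (2 * real (Suc n) + 1) * ?f (Suc n) * (\<Prod>k=1..n. ?f k)"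
    by (simp only: prod.nat_ivl_Suc' mult.assoc le_add1 plus_1_eq_Suc)
  also have "\<dots> = 1"
    unfolding step by (rule Suc)
  finally show ?case .
qed simp

definition cbin_norm :: "nat \<Rightarrow> real" where
  "cbin_norm N = cbin N * (2 * real N + 1)\<^sup>2 / (real N + 1)"

lemma cbin_norm_tendsto: "cbin_norm \<longlonglongrightarrow> 4 / pi"
proof -
  let ?P = "\<lambda>n. \<Prod>k=1..n. (4 * real k ^ 2) / (4 * real k ^ 2 - 1)"
  \<comment> \<open>By \<open>cbin_wallis\<close> one factor 2n+1 of \<open>cbin_norm\<close> turns
    \<open>cbin n\<close> into the inverse Wallis product, with limit 2/pi; the other, divided by
    n+1, tends to 2.\<close>
  have "(\<lambda>n. inverse (?P n) * ((2 * real n + 1) / (real n + 1))) \<longlonglongrightarrow> inverse (pi / 2) * 2"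
    by (intro tendsto_mult tendsto_inverse wallis) (simp, real_asymp)
  moreover have "inverse (?P n) * ((2 * real n + 1) / (real n + 1)) = cbin_norm n" for n
    using inverse_unique[of "?P n" "cbin n * (2 * real n + 1)"] cbin_wallis[of n]
    by (simp add: cbin_norm_def power2_eq_square mult_ac)
  ultimately show ?thesis by (simp add: field_simps)
qed

section \<open>The weighted transform and its summation against \<open>cbin\<close>\<close>

definition binom_transform :: "(nat \<Rightarrow> real) \<Rightarrow> nat \<Rightarrow> real" where
  "binom_transform x N = (\<Sum>n\<le>N. (2 * real n + 1) * binom_weight N n * x n) / (real N + 1)"

text \<open>This is the coefficient of \<open>x n\<close> in the induction step for
  \<open>sum_cbin_binom_transform\<close>. With everything expressed at \<open>Suc N\<close>, it
  comes down to (2N+3)^2 - 4(N+1-n)(N+n+2) = (2n+1)^2.\<close>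

lemma cbin_norm_step:
  "cbin_norm (Suc N) * binom_weight (Suc N) n / (2 * real n + 1) - cbin_norm N * binom_weight N n / (2 * real n + 1)
    = cbin (Suc N) * (2 * real n + 1) * binom_weight (Suc N) n / (real N + 2)"
proof -
  have binom_weight: "binom_weight N n = (real N + 1 - real n) * (real N + real n + 2) * binom_weight (Suc N) n / ((real N + 1) * (real N + 2))"
    by (subst binom_weight_Suc_left[symmetric]) simp
  have c: "cbin_norm N = 4 * (real N + 1) * cbin (Suc N)"
    by (simp add: cbin_norm_def cbin_Suc divide_simps) (simp add: power2_eq_square algebra_simps)
  have c': "cbin_norm (Suc N) = cbin (Suc N) * (2 * real N + 3)\<^sup>2 / (real N + 2)"
    by (simp add: cbin_norm_def add_ac)
  show ?thesis
    unfolding binom_weight c c' by (simp add: divide_simps) (simp add: power2_eq_square algebra_simps)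
qed

lemma sum_cbin_binom_transform:
  "(\<Sum>k\<le>N. cbin k * binom_transform x k) = cbin_norm N * (\<Sum>n\<le>N. binom_weight N n * (x n / (2 * real n + 1)))"
proof (induction N)
  case 0
  show ?case by (simp add: binom_transform_def cbin_norm_def)
next
  case (Suc N)
  \<comment> \<open>The sum for \<open>N\<close> is also taken up to \<open>Suc N\<close>; the extra
    term is zero since \<open>binom_weight N (Suc N) = 0\<close>.\<close>
  have "cbin_norm (Suc N) * (\<Sum>n\<le>Suc N. binom_weight (Suc N) n * (x n / (2 * real n + 1)))
      - cbin_norm N * (\<Sum>n\<le>Suc N. binom_weight N n * (x n / (2 * real n + 1)))
      = (\<Sum>n\<le>Suc N. (cbin_norm (Suc N) * binom_weight (Suc N) n / (2 * real n + 1) - cbin_norm N * binom_weight N n / (2 * real n + 1)) * x n)"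
    unfolding sum_distrib_left sum_subtractf[symmetric]
    by (intro sum.cong) (auto simp: algebra_simps simp del: of_nat_Suc)
  also have "\<dots> = cbin (Suc N) * binom_transform x (Suc N)"
    unfolding cbin_norm_step binom_transform_def sum_divide_distrib sum_distrib_left
    by (intro sum.cong) (auto simp: algebra_simps)
  finally show ?case using Suc by simp
qed

text \<open>Tannery's theorem: the weights are bounded by 1 and tend to 1, so the limit passes
  through the sum on the right of \<open>sum_cbin_binom_transform\<close>.\<close>

lemma cbin_binom_transform_sums:
  assumes "summable (\<lambda>n. \<bar>x n\<bar> / (2 * real n + 1))"
  shows "(\<lambda>k. cbin k * binom_transform x k) sums (4 / pi * (\<Sum>n. x n / (2 * real n + 1)))"
proof -
  let ?a = "\<lambda>n N. binom_weight N n * (x n / (2 * real n + 1))"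
  have "(\<lambda>N. suminf (\<lambda>n. ?a n N)) \<longlonglongrightarrow> (\<Sum>n. x n / (2 * real n + 1))"
  proof (rule tannerys_theorem[THEN conjunct2, THEN conjunct2])
    show "((\<lambda>N. ?a n N) \<longlongrightarrow> x n / (2 * real n + 1)) sequentially" for n
      using tendsto_mult[OF binom_weight_tendsto_1[of n] tendsto_const[of "x n / (2 * real n + 1)"]] by simp
    show "eventually (\<lambda>(n, N). norm (?a n N) \<le> \<bar>x n\<bar> / (2 * real n + 1)) (at_top \<times>\<^sub>F sequentially)"
      using mult_right_mono[OF binom_weight_le_1]
      by (intro always_eventually) (auto simp: abs_mult binom_weight_nonneg divide_right_mono mult_left_le_one_le binom_weight_le_1)
  qed (use assms in auto)
  moreover have "suminf (\<lambda>n. ?a n N) = (\<Sum>n\<le>N. ?a n N)" for N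
    by (rule suminf_finite) auto
  ultimately have "(\<lambda>N. \<Sum>n\<le>N. ?a n N) \<longlonglongrightarrow> (\<Sum>n. x n / (2 * real n + 1))" by simp
  from tendsto_mult[OF cbin_norm_tendsto this] show ?thesis
    unfolding sums_def_le sum_cbin_binom_transform .
qed

section \<open>Generating functions of the harmonic sums\<close>

unbundle no vec_syntax
unbundle fps_syntax

text \<open>The product of 1 + X/j over j = 1, ..., n: its coefficients are the elementary symmetric
  polynomials in the numbers 1/j.\<close>

definition mhs_gf :: "nat \<Rightarrow> real fps" where
  "mhs_gf n = Abs_fps (\<lambda>k. mhs n (ones k))"

text \<open>The product of 1/(1 - X/j) over j = 1, ..., n, with the complete homogeneous symmetric
  polynomials as coefficients.\<close>

definition mhs_star_gf :: "nat \<Rightarrow> real fps" where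
  "mhs_star_gf n = Abs_fps (\<lambda>k. mhs_star n (ones k))"

lemma mhs_gf_0: "mhs_gf 0 = 1"
proof (rule fps_ext)
  show "mhs_gf 0 $ k = 1 $ k" for k
    by (cases k) (auto simp: mhs_gf_def)
qed

lemma mhs_star_gf_0: "mhs_star_gf 0 = 1"
proof (rule fps_ext)
  show "mhs_star_gf 0 $ k = 1 $ k" for k
    by (cases k) (auto simp: mhs_star_gf_def)
qed

lemma mhs_gf_Suc: "of_nat (Suc n) * mhs_gf (Suc n) = (of_nat (Suc n) + fps_X) * mhs_gf n"
proof (rule fps_ext)
  fix k
  show "(of_nat (Suc n) * mhs_gf (Suc n)) $ k = ((of_nat (Suc n) + fps_X) * mhs_gf n) $ k"
    by (cases k) (simp_all add: fps_of_nat[symmetric] mhs_gf_def mhs_Suc_Cons distrib_right field_simps del: of_nat_Suc)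
qed

lemma mhs_star_gf_Suc: "(of_nat (Suc n) - fps_X) * mhs_star_gf (Suc n) = of_nat (Suc n) * mhs_star_gf n"
proof (rule fps_ext)
  fix k
  show "((of_nat (Suc n) - fps_X) * mhs_star_gf (Suc n)) $ k = (of_nat (Suc n) * mhs_star_gf n) $ k"
    by (cases k) (simp_all add: fps_of_nat[symmetric] mhs_star_gf_def mhs_star_Suc_Cons left_diff_distrib field_simps del: of_nat_Suc)
qed

text \<open>\<open>poch_ratio n\<close> is \<open>(X)\<^sub>n / (1 - X)\<^sub>n\<^sub>+\<^sub>1\<close> in terms of Pochhammer symbols.\<close>

definition poch_ratio :: "nat \<Rightarrow> real fps" where
  "poch_ratio n = (if n = 0 then mhs_star_gf 1
    else fps_const (1 / (real n * (real n + 1))) * (fps_X * mhs_gf (n - 1) * mhs_star_gf (n + 1)))"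

text \<open>Passing from \<open>n\<close> to \<open>Suc n\<close> multiplies the numerator by X + n
  and the denominator by n + 2 - X. The step from 0 to 1 is separate because the definition branches
  there.\<close>

lemma poch_ratio_Suc: "(of_nat n + 2 - fps_X) * poch_ratio (Suc n) = (of_nat n + fps_X) * poch_ratio n"
proof (cases n)
  case 0
  have "(2 - fps_X) * mhs_star_gf 2 = 2 * mhs_star_gf 1"
    using mhs_star_gf_Suc[of 1] by (simp add: numeral_2_eq_2)
  moreover have "fps_const (1 / 2) * 2 = (1 :: real fps)"
    by (simp add: fps_numeral_fps_const)
  ultimately have "(2 - fps_X) * (fps_const (1 / 2) * (fps_X * mhs_star_gf 2)) = fps_X * mhs_star_gf 1"
    by algebra
  then show ?thesis
    using 0 by (simp add: poch_ratio_def mhs_gf_0 numeral_2_eq_2)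
next
  case (Suc j)
  define a b where "a = (of_nat (Suc j) :: real fps)" and "b = (of_nat (Suc (Suc (Suc j))) :: real fps)"
  have star: "(b - fps_X) * mhs_star_gf (Suc (Suc (Suc j))) = b * mhs_star_gf (Suc (Suc j))"
    using mhs_star_gf_Suc[of "Suc (Suc j)"] by (simp only: b_def)
  have nonstar: "a * mhs_gf (Suc j) = (a + fps_X) * mhs_gf j"
    using mhs_gf_Suc[of j] by (simp only: a_def)
  define u v where "u = fps_const (1 / (real (Suc j) * (real (Suc j) + 1)))"
    and "v = fps_const (1 / (real (Suc (Suc j)) * (real (Suc (Suc j)) + 1)))"
  have uv: "v * b = u * a"
    unfolding u_def v_def a_def b_def fps_of_nat[symmetric] fps_const_mult
    by (rule arg_cong[of _ _ fps_const]) (simp add: divide_simps)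
  have "(b - fps_X) * (v * (fps_X * mhs_gf (Suc j) * mhs_star_gf (Suc (Suc (Suc j)))))
      = (a + fps_X) * (u * (fps_X * mhs_gf j * mhs_star_gf (Suc (Suc j))))"
    using star nonstar uv by algebra
  moreover have "of_nat n + 2 = b" "of_nat n = a"
    by (simp_all add: Suc a_def b_def)
  moreover have "poch_ratio (Suc n) = v * (fps_X * mhs_gf (Suc j) * mhs_star_gf (Suc (Suc (Suc j))))"
    "poch_ratio n = u * (fps_X * mhs_gf j * mhs_star_gf (Suc (Suc j)))"
    by (simp_all add: Suc poch_ratio_def u_def v_def)
  ultimately show ?thesis
    by (simp only:)
qed

text \<open>The factor X shifts the Cauchy product to k = 1, ..., m. At \<open>n = 0\<close> the
  series is geometric; its coefficient 1 becomes the isolated 1 in the theorem.\<close>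

lemma poch_ratio_nth:
  "poch_ratio n $ m = (if n = 0 then 1 else
    (\<Sum>k=1..m. mhs (n - 1) (ones (k - 1)) * mhs_star (n + 1) (ones (m - k))) / (real n * (real n + 1)))"
proof (cases "n = 0")
  case True
  have "(1 - fps_X) * mhs_star_gf 1 = 1"
    using mhs_star_gf_Suc[of 0] by (simp add: mhs_star_gf_0)
  moreover have "(1 - fps_X) * Abs_fps (\<lambda>_. 1 :: real) = 1"
    by (rule fps_ext) (auto simp: left_diff_distrib)
  ultimately have "mhs_star_gf 1 = Abs_fps (\<lambda>_. 1 :: real)"
    by (metis mult.left_commute mult.right_neutral)
  with True show ?thesis by (simp add: poch_ratio_def)
next
  case False
  have "(fps_X * mhs_gf (n - 1) * mhs_star_gf (n + 1)) $ m
      = (\<Sum>k=1..m. mhs (n - 1) (ones (k - 1)) * mhs_star (n + 1) (ones (m - k)))"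
  proof (cases m)
    case (Suc l)
    have "(fps_X * (mhs_gf (n - 1) * mhs_star_gf (n + 1))) $ Suc l
        = (\<Sum>k=0..l. mhs_gf (n - 1) $ k * mhs_star_gf (n + 1) $ (l - k))"
      by (simp only: fps_X_mult_nth fps_mult_nth[of "mhs_gf (n - 1)"]) simp
    also have "\<dots> = (\<Sum>k=1..m. mhs_gf (n - 1) $ (k - 1) * mhs_star_gf (n + 1) $ (m - k))"
      unfolding Suc One_nat_def sum.shift_bounds_cl_Suc_ivl by simp
    finally show ?thesis by (simp add: Suc mhs_gf_def mhs_star_gf_def mult.assoc)
  qed (simp add: mult.assoc)
  with False show ?thesis by (simp add: poch_ratio_def)
qed

section \<open>Two evaluations by creative telescoping\<close>

text \<open>Lifted to power series so that the telescoping identities can be checked in a single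
  ring.\<close>

lemma binom_weight_Suc_right_fps:
  "fps_const (binom_weight (Suc N) (Suc n)) * (of_nat N + of_nat n + 3)
    = (of_nat N + 1 - of_nat n) * fps_const (binom_weight (Suc N) n)"
proof -
  have *: "fps_const (binom_weight (Suc N) (Suc n)) * fps_const (real (Suc N) + real n + 2)
      = fps_const (real (Suc N) - real n) * fps_const (binom_weight (Suc N) n)"
    unfolding fps_const_mult binom_weight_Suc_right ..
  have 1: "fps_const (real (Suc N) + real n + 2) = of_nat N + of_nat n + 3"
    by (simp add: fps_of_nat[symmetric] fps_numeral_fps_const)
  have 2: "fps_const (real (Suc N) - real n) = of_nat N + 1 - of_nat n"
    by (simp add: fps_of_nat[symmetric] flip: fps_const_1_eq_1)
  show ?thesis
    using * unfolding 1 2 .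
qed

lemma binom_weight_Suc_left_fps:
  "(of_nat N + 1) * (of_nat N + 2) * fps_const (binom_weight N n)
    = (of_nat N + 1 - of_nat n) * (of_nat N + of_nat n + 2) * fps_const (binom_weight (Suc N) n)"
proof -
  have "fps_const (real N + 1) * fps_const (real N + 2) * fps_const (binom_weight N n)
    = fps_const (real N + 1 - real n) * fps_const (real N + real n + 2) * fps_const (binom_weight (Suc N) n)"
    unfolding fps_const_mult binom_weight_Suc_left ..
  then show ?thesis
    by (simp add: fps_of_nat[symmetric] fps_numeral_fps_const flip: fps_const_1_eq_1)
qed

definition weighted_sum :: "nat \<Rightarrow> real fps" where
  "weighted_sum N = (\<Sum>n\<le>N. (2 * of_nat n + 1) * fps_const (binom_weight N n) * poch_ratio n)"

definition alternating_weighted_sum :: "nat \<Rightarrow> real fps" where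
  "alternating_weighted_sum N = (\<Sum>n\<le>N. (2 * of_nat n + 1) * fps_const (binom_weight N n) * ((-1) ^ n * poch_ratio n))"

lemma weighted_sum_step:
  "(of_nat N + 1) * ((of_nat N + 2 - fps_X) * weighted_sum (Suc N)) = (of_nat N + 1) * ((of_nat N + 2) * weighted_sum N)"
proof -
  \<comment> \<open>Telescoping certificate. The factor n + 1 - X cancels the last denominator
    factor of \<open>poch_ratio n\<close>, so by \<open>poch_ratio_Suc\<close> both
    \<open>G (Suc n)\<close> and \<open>G n\<close> are multiples of
    \<open>poch_ratio n\<close>.\<close>
  define G where "G n = - (of_nat n * (of_nat N + of_nat n + 2) * fps_const (binom_weight (Suc N) n)
      * ((of_nat n + 1 - fps_X) * poch_ratio n))" for n
  have step: "(of_nat N + 1) * ((of_nat N + 2 - fps_X)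
        * ((2 * of_nat n + 1) * fps_const (binom_weight (Suc N) n) * poch_ratio n))
      - (of_nat N + 1) * ((of_nat N + 2) * ((2 * of_nat n + 1) * fps_const (binom_weight N n) * poch_ratio n)) = G (Suc n) - G n" for n
  proof -
    define m k where "m = (of_nat N :: real fps)" and "k = (of_nat n :: real fps)"
    note * = binom_weight_Suc_right_fps[of N n] binom_weight_Suc_left_fps[of N n] poch_ratio_Suc[of n]
    have "of_nat (Suc n) = k + 1" by (simp add: k_def)
    then show ?thesis
      using * unfolding G_def m_def[symmetric] k_def[symmetric] by algebra
  qed
  have "(of_nat N + 1) * ((of_nat N + 2 - fps_X) * weighted_sum (Suc N)) - (of_nat N + 1) * ((of_nat N + 2) * weighted_sum N)
      = (\<Sum>n\<le>Suc N. G (Suc n) - G n)"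
    unfolding weighted_sum_def step[symmetric] sum_subtractf sum_distrib_left by simp
  also have "\<dots> = 0"
    \<comment> \<open>\<open>G 0\<close> vanishes through its factor n, and
      \<open>G (Suc (Suc N))\<close> because the weight is zero there.\<close>
    unfolding lessThan_Suc_atMost[symmetric] sum_lessThan_telescope by (simp add: G_def)
  finally show ?thesis by simp
qed

lemma weighted_sum_eq: "weighted_sum N = mhs_star_gf (Suc N)"
proof (induction N)
  case 0
  show ?case by (simp add: weighted_sum_def poch_ratio_def)
next
  case (Suc N)
  \<comment> \<open>Power series over the reals form an integral domain, so both factors may be
    cancelled; the second has constant coefficient N + 2.\<close>
  have nz: "of_nat N + 1 \<noteq> (0 :: real fps)" "of_nat N + 2 - fps_X \<noteq> (0 :: real fps)"
    using of_nat_neq_0[of N, where 'a = "real fps"] arg_cong[of "of_nat N + 2 - fps_X" "0 :: real fps" "\<lambda>f. f $ 0"]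
    by (auto simp: add_ac fps_of_nat[symmetric])
  have "(of_nat N + 2 - fps_X) * weighted_sum (Suc N) = (of_nat N + 2) * mhs_star_gf (Suc N)"
    using weighted_sum_step[of N] nz(1) Suc by simp
  also have "\<dots> = (of_nat N + 2 - fps_X) * mhs_star_gf (Suc (Suc N))"
    using mhs_star_gf_Suc[of "Suc N"] by (simp add: add_ac)
  finally show ?case using nz(2) by simp
qed

lemma alternating_weighted_sum_step:
  "(of_nat N + 1) * (of_nat N + 1) * ((of_nat N + 2 - fps_X) * alternating_weighted_sum (Suc N))
    = (of_nat N + 1) * (of_nat N + 2) * ((of_nat N + 1 - fps_X) * alternating_weighted_sum N)"
proof -
  \<comment> \<open>Compared with the certificate for \<open>weighted_sum_step\<close> there is a
    second factor n and the alternating sign, which makes \<open>G (Suc n)\<close> enter with a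
    plus.\<close>
  define G where "G n = - ((-1) ^ n * (of_nat n ^ 2 * (of_nat N + of_nat n + 2) * fps_const (binom_weight (Suc N) n)
      * ((of_nat n + 1 - fps_X) * poch_ratio n)))" for n
  have step: "(of_nat N + 1) * (of_nat N + 1) * ((of_nat N + 2 - fps_X)
        * ((2 * of_nat n + 1) * fps_const (binom_weight (Suc N) n) * ((-1) ^ n * poch_ratio n)))
      - (of_nat N + 1) * (of_nat N + 2) * ((of_nat N + 1 - fps_X)
        * ((2 * of_nat n + 1) * fps_const (binom_weight N n) * ((-1) ^ n * poch_ratio n)))
      = G (Suc n) - G n" for n
  proof -
    define m k where "m = (of_nat N :: real fps)" and "k = (of_nat n :: real fps)"
    define s :: "real fps" where "s = (-1) ^ n"
    have k: "of_nat (Suc n) = k + 1" by (simp add: k_def)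
    have "G (Suc n) = s * ((k + 1)\<^sup>2 * (fps_const (binom_weight (Suc N) (Suc n)) * (m + k + 3))
        * ((k + 2 - fps_X) * poch_ratio (Suc n)))"
      unfolding G_def k power_Suc by (simp add: m_def s_def algebra_simps)
    also have "\<dots> = s * ((k + 1)\<^sup>2 * ((m + 1 - k) * fps_const (binom_weight (Suc N) n)) * ((k + fps_X) * poch_ratio n))"
      unfolding m_def k_def binom_weight_Suc_right_fps poch_ratio_Suc ..
    finally have G: "G (Suc n) = \<dots>" .
    have "(m + 1) * (m + 2) * ((m + 1 - fps_X) * ((2 * k + 1) * fps_const (binom_weight N n) * (s * poch_ratio n)))
        = (m + 1) * (m + 2) * fps_const (binom_weight N n) * ((m + 1 - fps_X) * (2 * k + 1) * s * poch_ratio n)"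
      by (simp only: mult_ac)
    also have "\<dots> = (m + 1 - k) * (m + k + 2) * fps_const (binom_weight (Suc N) n)
        * ((m + 1 - fps_X) * (2 * k + 1) * s * poch_ratio n)"
      unfolding m_def k_def binom_weight_Suc_left_fps ..
    finally have lower: "(m + 1) * (m + 2) * ((m + 1 - fps_X)
        * ((2 * k + 1) * fps_const (binom_weight N n) * (s * poch_ratio n))) = \<dots>" .
    have "(m + 1) * (m + 1) * ((m + 2 - x) * ((2 * k + 1) * c * (s * l)))
        - (m + 1 - k) * (m + k + 2) * c * ((m + 1 - x) * (2 * k + 1) * s * l)
        = s * ((k + 1)\<^sup>2 * ((m + 1 - k) * c) * ((k + x) * l))
          - - (s * (k\<^sup>2 * (m + k + 2) * c * ((k + 1 - x) * l)))" for x c l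
      by (simp add: algebra_simps power2_eq_square)
    then show ?thesis
      unfolding G unfolding G_def[of n] m_def[symmetric] k_def[symmetric] s_def[symmetric] lower .
  qed
  have "(of_nat N + 1) * (of_nat N + 1) * ((of_nat N + 2 - fps_X) * alternating_weighted_sum (Suc N))
      - (of_nat N + 1) * (of_nat N + 2) * ((of_nat N + 1 - fps_X) * alternating_weighted_sum N)
      = (\<Sum>n\<le>Suc N. G (Suc n) - G n)"
    unfolding alternating_weighted_sum_def step[symmetric] sum_subtractf sum_distrib_left by simp
  also have "\<dots> = 0"
    unfolding lessThan_Suc_atMost[symmetric] sum_lessThan_telescope by (simp add: G_def)
  finally show ?thesis by simp
qed

text \<open>The recurrence says that this left-hand side divided by N + 1 does not change with
  \<open>N\<close>; at \<open>N = 0\<close> it is 1.\<close>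

lemma alternating_weighted_sum_eq: "(of_nat N + 1 - fps_X) * alternating_weighted_sum N = of_nat N + 1"
proof (induction N)
  case 0
  have "(1 - fps_X) * mhs_star_gf 1 = 1"
    using mhs_star_gf_Suc[of 0] by (simp add: mhs_star_gf_0)
  then show ?case by (simp add: alternating_weighted_sum_def poch_ratio_def)
next
  case (Suc N)
  have nz: "of_nat N + 1 \<noteq> (0 :: real fps)"
    using of_nat_neq_0[of N, where 'a = "real fps"] by (simp add: add_ac)
  have "(of_nat N + 1) * (of_nat N + 1) * ((of_nat N + 2 - fps_X) * alternating_weighted_sum (Suc N))
      = (of_nat N + 1) * (of_nat N + 1) * (of_nat N + 2)"
    unfolding alternating_weighted_sum_step Suc by (simp add: mult_ac)
  then show ?case using nz by (simp add: add_ac)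
qed

lemma alternating_weighted_sum_nth: "alternating_weighted_sum N $ m = 1 / (real N + 1) ^ m"
proof (induction m)
  case 0
  show ?case using arg_cong[OF alternating_weighted_sum_eq[of N], of "\<lambda>f. f $ 0"]
    by (simp add: fps_of_nat[symmetric])
next
  case (Suc m)
  have "(real N + 1) * alternating_weighted_sum N $ Suc m = alternating_weighted_sum N $ m"
    using arg_cong[OF alternating_weighted_sum_eq[of N], of "\<lambda>f. f $ Suc m"]
    by (simp add: fps_of_nat[symmetric] left_diff_distrib distrib_right)
  then have "alternating_weighted_sum N $ Suc m = alternating_weighted_sum N $ m / (real N + 1)"
    by (simp add: field_simps)
  with Suc show ?case by simp
qed

lemma odd_const_mult_nth:
  "((2 * of_nat n + 1) * fps_const c * f) $ m = (2 * real n + 1) * c * f $ m"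
proof -
  have "2 * of_nat n + 1 = fps_const (2 * real n + 1)"
    by (simp add: fps_of_nat[symmetric] fps_numeral_fps_const flip: fps_const_1_eq_1)
  then show ?thesis by (simp add: mult.assoc)
qed

lemma binom_transform_poch_ratio: "binom_transform (\<lambda>n. poch_ratio n $ m) N = mhs_star (N + 1) (ones m) / (real N + 1)"
proof -
  have "mhs_star (N + 1) (ones m) = weighted_sum N $ m"
    by (simp add: weighted_sum_eq mhs_star_gf_def)
  also have "\<dots> = (\<Sum>n\<le>N. (2 * real n + 1) * binom_weight N n * poch_ratio n $ m)"
    by (simp only: weighted_sum_def fps_sum_nth odd_const_mult_nth)
  finally show ?thesis by (simp add: binom_transform_def)
qed

lemma binom_transform_alternating_poch_ratio: "binom_transform (\<lambda>n. (-1) ^ n * poch_ratio n $ m) N = 1 / (real N + 1) ^ (m + 1)"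
proof -
  have "1 / (real N + 1) ^ m = alternating_weighted_sum N $ m"
    by (simp add: alternating_weighted_sum_nth)
  also have "\<dots> = (\<Sum>n\<le>N. (2 * real n + 1) * binom_weight N n * ((-1) ^ n * poch_ratio n $ m))"
    by (auto simp: alternating_weighted_sum_def fps_sum_nth odd_const_mult_nth minus_one_power_iff intro!: sum.cong)
  finally have *: "1 / (real N + 1) ^ m = \<dots>" .
  show ?thesis
    unfolding binom_transform_def *[symmetric] by simp
qed

section \<open>Summability of the right-hand sides and conclusion\<close>

lemma summable_harmonic_term:
  fixes \<sigma> :: "nat \<Rightarrow> real"
  assumes "\<And>n. \<bar>\<sigma> n\<bar> \<le> 1"
  shows "summable (\<lambda>n. mhs n (ones a) * mhs_star (n + 2) (ones b)
      / (real (Suc n) * (real (Suc n) + 1) * (2 * real (Suc n) + 1)) * \<sigma> n)"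
proof (rule summable_comparison_test[OF _ summable_harm_power_over_square[of "a + b"]], intro exI allI impI)
  fix n
  let ?d = "real (Suc n) * (real (Suc n) + 1) * (2 * real (Suc n) + 1)"
  \<comment> \<open>A quadratic lower bound for the cubic denominator suffices, as the numerators
    grow only like powers of logarithms.\<close>
  have d: "real (Suc n) ^ 2 \<le> ?d"
    by (simp add: power2_eq_square algebra_simps)
  have "mhs n (ones a) \<le> harm (Suc (Suc n)) ^ a"
    by (rule order_trans[OF mhs_ones_le power_mono[OF harm_mono harm_nonneg]]) simp
  moreover have "mhs_star (n + 2) (ones b) \<le> harm (Suc (Suc n)) ^ b"
    using mhs_star_ones_le[of "n + 2" b] by simp
  ultimately have "mhs n (ones a) * mhs_star (n + 2) (ones b) \<le> harm (Suc (Suc n)) ^ (a + b)"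
    unfolding power_add by (intro mult_mono mhs_nonneg mhs_star_nonneg zero_le_power harm_nonneg)
  then have "mhs n (ones a) * mhs_star (n + 2) (ones b) / ?d
      \<le> harm (Suc (Suc n)) ^ (a + b) / real (Suc n) ^ 2"
    by (rule frac_le[rotated]) (use d in \<open>auto simp: harm_nonneg\<close>)
  moreover have "\<bar>mhs n (ones a) * mhs_star (n + 2) (ones b) / ?d * \<sigma> n\<bar>
      \<le> mhs n (ones a) * mhs_star (n + 2) (ones b) / ?d"
  proof -
    have "mhs n (ones a) * mhs_star (n + 2) (ones b) / ?d \<ge> 0"
      by (intro divide_nonneg_nonneg mult_nonneg_nonneg mhs_nonneg mhs_star_nonneg) auto
    then show ?thesis
      by (simp only: abs_mult abs_of_nonneg mult_left_le[OF assms])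
  qed
  ultimately show "norm (mhs n (ones a) * mhs_star (n + 2) (ones b) / ?d * \<sigma> n)
      \<le> harm (Suc (Suc n)) ^ (a + b) / real (Suc n) ^ 2"
    by simp
qed

theorem theorem5p1:
  fixes m :: nat
  shows "let t = (\<lambda>k n. mhs (n - 1) (ones (k - 1)) * mhs_star (n + 1) (ones (m - k))
                     / (real n * (real n + 1) * (2 * real n + 1)))
    in (\<forall>k\<in>{1..m}. summable (\<lambda>n. t k (Suc n) * (- 1) ^ Suc n)) \<and>
       (\<lambda>n. (1 / 4 ^ n * real ((2 * n) choose n))\<^sup>2 * (1 / (real n + 1) ^ (m + 1))) sums
         (4 / pi * (1 + (\<Sum>k=1..m. \<Sum>n. t k (Suc n) * (- 1) ^ Suc n))) \<and>
       (\<forall>k\<in>{1..m}. summable (\<lambda>n. t k (Suc n))) \<and>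
       (\<lambda>n. (1 / 4 ^ n * real ((2 * n) choose n))\<^sup>2 * (mhs_star (n + 1) (ones m) / (real n + 1))) sums
         (4 / pi * (1 + (\<Sum>k=1..m. \<Sum>n. t k (Suc n))))"
proof -
  define t where "t k n = mhs (n - 1) (ones (k - 1)) * mhs_star (n + 1) (ones (m - k))
                     / (real n * (real n + 1) * (2 * real n + 1))" for k n
  have summable_t: "summable (\<lambda>n. t k (Suc n) * \<sigma> n)" if "\<And>n. \<bar>\<sigma> n\<bar> \<le> 1" for k and \<sigma> :: "nat \<Rightarrow> real"
    using summable_harmonic_term[of \<sigma> "k - 1" "m - k", OF that] by (simp add: t_def)
  have poch_ratio_t: "poch_ratio (Suc n) $ m / (2 * real (Suc n) + 1) = (\<Sum>k=1..m. t k (Suc n))" for n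
    by (simp add: poch_ratio_nth t_def sum_divide_distrib)
  have poch_ratio_nonneg: "poch_ratio (Suc n) $ m \<ge> 0" for n
    unfolding poch_ratio_nth by (auto simp: mhs_nonneg mhs_star_nonneg intro!: sum_nonneg divide_nonneg_nonneg)
  \<comment> \<open>Both identities at once: \<open>\<sigma>\<close> is later the alternating sign
    or the constant 1.\<close>
  have sums: "(\<lambda>n. cbin n * binom_transform (\<lambda>n. \<sigma> n * poch_ratio n $ m) n) sums
      (4 / pi * (1 + (\<Sum>k=1..m. \<Sum>n. t k (Suc n) * \<sigma> (Suc n))))"
    if \<sigma>: "\<And>n. \<bar>\<sigma> n\<bar> = 1" "\<sigma> 0 = 1" for \<sigma> :: "nat \<Rightarrow> real"
  proof -
    have "summable (\<lambda>n. \<bar>poch_ratio (Suc n) $ m\<bar> / (2 * real (Suc n) + 1))"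
    proof -
      have "\<bar>poch_ratio (Suc n) $ m\<bar> / (2 * real (Suc n) + 1) = (\<Sum>k=1..m. t k (Suc n) * 1)" for n
        unfolding mult_1_right poch_ratio_t[symmetric] using poch_ratio_nonneg[of n] by simp
      then show ?thesis
        using summable_t[of "\<lambda>_. 1"] by (simp add: summable_sum)
    qed
    then have abs: "summable (\<lambda>n. \<bar>\<sigma> n * poch_ratio n $ m\<bar> / (2 * real n + 1))"
      by (subst summable_Suc_iff[symmetric]) (simp add: abs_mult \<sigma>)
    then have "summable (\<lambda>n. \<bar>\<sigma> n * poch_ratio n $ m / (2 * real n + 1)\<bar>)"
      by (simp add: abs_divide)
    then have "summable (\<lambda>n. \<sigma> n * poch_ratio n $ m / (2 * real n + 1))"
      by (rule summable_rabs_cancel)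
    \<comment> \<open>The term at 0 equals 1 and is split off; this is the 1 inside the braces of
      the theorem.\<close>
    then have "(\<Sum>n. \<sigma> n * poch_ratio n $ m / (2 * real n + 1))
        = 1 + (\<Sum>n. \<sigma> (Suc n) * poch_ratio (Suc n) $ m / (2 * real (Suc n) + 1))"
      by (subst suminf_split_head) (auto simp: poch_ratio_nth \<sigma>)
    also have "(\<lambda>n. \<sigma> (Suc n) * poch_ratio (Suc n) $ m / (2 * real (Suc n) + 1))
        = (\<lambda>n. \<Sum>k=1..m. t k (Suc n) * \<sigma> (Suc n))"
      unfolding sum_distrib_right[symmetric] poch_ratio_t[symmetric] by (simp add: mult.commute)
    also have "suminf \<dots> = (\<Sum>k=1..m. \<Sum>n. t k (Suc n) * \<sigma> (Suc n))"
      by (intro suminf_sum summable_t) (simp add: \<sigma>)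
    finally show ?thesis
      using cbin_binom_transform_sums[OF abs] by simp
  qed
  have "(\<lambda>n. cbin n * (1 / (real n + 1) ^ (m + 1))) sums
      (4 / pi * (1 + (\<Sum>k=1..m. \<Sum>n. t k (Suc n) * (-1) ^ Suc n)))"
    using sums[of "\<lambda>n. (-1) ^ n"] unfolding binom_transform_alternating_poch_ratio by simp
  moreover have "(\<lambda>n. cbin n * (mhs_star (n + 1) (ones m) / (real n + 1))) sums
      (4 / pi * (1 + (\<Sum>k=1..m. \<Sum>n. t k (Suc n))))"
    using sums[of "\<lambda>_. 1"] by (simp add: binom_transform_poch_ratio)
  moreover have "summable (\<lambda>n. t k (Suc n) * (-1) ^ Suc n)" "summable (\<lambda>n. t k (Suc n))" for k
    using summable_t[of "\<lambda>n. (-1) ^ Suc n" k] summable_t[of "\<lambda>_. 1" k] by simp_all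
  ultimately have "(\<forall>k\<in>{1..m}. summable (\<lambda>n. t k (Suc n) * (-1) ^ Suc n)) \<and>
      (\<lambda>n. cbin n * (1 / (real n + 1) ^ (m + 1))) sums
        (4 / pi * (1 + (\<Sum>k=1..m. \<Sum>n. t k (Suc n) * (-1) ^ Suc n))) \<and>
      (\<forall>k\<in>{1..m}. summable (\<lambda>n. t k (Suc n))) \<and>
      (\<lambda>n. cbin n * (mhs_star (n + 1) (ones m) / (real n + 1))) sums
        (4 / pi * (1 + (\<Sum>k=1..m. \<Sum>n. t k (Suc n))))"
    by blast
  then show ?thesis
    unfolding Let_def t_def cbin_def .
qed

end
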